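(* Let $s>0$ and assume $a>0$ satisfies $a+2\langle k\rangle+N>2$ (so that the Plancherel theorem for $\mathcal{F}_{k,a}$ is valid). Then there exists a constant $C'>0$ such that for all $f\in (L^1_{k,a}\cap L^2_{k,a})(\mathbb{R}^N)$ \[\bigl\|\|\cdot\|^{2s}f\bigr\|_{L^1_{k,a}}\bigl\|\|\cdot\|^s\mathcal{F}_{k,a}f\bigr\|^2_{L^2_{k,a}}\ge C'\|f\|_{L^1_{k,a}}\|f\|^2_{L^2_{k,a}}.\]
   Context: Let $N\ge1$ and let $\langle\cdot,\cdot\rangle$, $\|\cdot\|$ be the Euclidean inner product and norm on $\mathbb{R}^N$. Let $\mathcal{R}\subset\mathbb{R}^N\setminus\{0\}$ be a reduced root system with positive subsystem $\mathcal{R}^+$, let $r_\alpha(x)=x-2\frac{\langle\alpha,x\rangle}{\|\alpha\|^2}\alpha$, let $\mathfrak{C}$ be the finite group generated by the $r_\alpha$, and let $k:\mathcal{R}\to[0,\infty)$, $\alpha\mapsto k_\alpha$, be a $\mathfrak{C}$-invariant (multiplicity) function; $\langle k\rangle=\sum_{\alpha\in\mathcal{R}^+}k_\alpha$. For $a>0$ put $\vartheta_k(x)=\prod_{\alpha\in\mathcal{R}^+}|\langle\alpha,x\rangle|^{2k_\alpha}$, $\vartheta_{k,a}(x)=\|x\|^{a-2}\vartheta_k(x)$, $d\mu_{k,a}(x)=\vartheta_{k,a}(x)\,dx$, $L^p_{k,a}(\mathbb{R}^N)=L^p(\mathbb{R}^N,\mu_{k,a})$. The Dunkl Laplacian is $\Delta_kf(x)=\Delta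 f(x)+\sum_{\alpha\in\mathcal{R}^+}k_\alpha\bigl(\frac{2\langle\nabla f(x),\alpha\rangle}{\langle\alpha,x\rangle}-\|\alpha\|^2\frac{f(x)-f(r_\alpha x)}{\langle\alpha,x\rangle^2}\bigr)$. If $a+2\langle k\rangle+N>2$, the $(k,a)$-generalized Fourier transform is the unitary operator on $L^2_{k,a}(\mathbb{R}^N)$ given by $\mathcal{F}_{k,a}=\exp\bigl[\frac{i\pi}{2a}(2\langle k\rangle+N+a-2)\bigr]\exp\bigl[\frac{i\pi}{2a}(\|x\|^{2-a}\Delta_k-\|x\|^a)\bigr]$. Equivalently, it is the unitary operator determined by $\mathcal{F}_{k,a}\Phi_{\ell}(p,\cdot)=e^{-i\pi(\ell+m/a)}\Phi_\ell(p,\cdot)$ for $\ell,m\in\{0,1,2,\dots\}$ and $p$ a homogeneous polynomial of degree $m$ with $\Delta_kp=0$, where $\Phi_\ell(p,x)=p(x)L_\ell^{(\lambda_m)}(\frac2a\|x\|^a)e^{-\|x\|^a/a}$, $\lambda_m=\frac1a(2m+2\langle k\rangle+N-2)$, and $L_\ell^{(\lambda)}$ are Laguerre polynomials (these functions span a dense subspace). Weighted norms may take the value $+\infty$. Standing assumption (boundedness of the integral kernel): there is a finite constant $C_0$ with $\|\mathcal{F}_{k,a}f\|_\infty\le C_0\|f\|_{L^1_{k,a}}$ for all $f\in L^1_{k,a}\cap L^2_{k,a}$. *)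

theory Defs
  imports "HOL-Analysis.Analysis" "HOL-Probability.Essential_Supremum"
begin

section \<open>Root systems\<close>

definition root_reflection :: "'a::euclidean_space \<Rightarrow> 'a \<Rightarrow> 'a" where
  "root_reflection \<alpha> x = x - (2 * (\<alpha> \<bullet> x) / (norm \<alpha>)\<^sup>2) *\<^sub>R \<alpha>"

text \<open>As usual in Dunkl theory, roots need be neither spanning nor crystallographic.\<close>

definition reduced_root_system :: "'a::euclidean_space set \<Rightarrow> bool" where
  "reduced_root_system R \<longleftrightarrow>
     finite R \<and> 0 \<notin> R \<and>
     (\<forall>\<alpha>\<in>R. root_reflection \<alpha> ` R = R) \<and>
     (\<forall>\<alpha>\<in>R. R \<inter> range (\<lambda>c. c *\<^sub>R \<alpha>) = {\<alpha>, - \<alpha>})"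

definition positive_subsystem :: "'a::euclidean_space set \<Rightarrow> 'a set \<Rightarrow> bool" where
  "positive_subsystem R Rp \<longleftrightarrow>
     (\<exists>\<beta>. (\<forall>\<alpha>\<in>R. \<alpha> \<bullet> \<beta> \<noteq> 0) \<and> Rp = {\<alpha>\<in>R. \<alpha> \<bullet> \<beta> > 0})"

text \<open>Reflections are involutions, so closure under composition already gives a group.\<close>

inductive_set reflection_group :: "('a::euclidean_space) set \<Rightarrow> ('a \<Rightarrow> 'a) set"
  for R :: "'a set" where
    id: "id \<in> reflection_group R"
  | comp: "\<lbrakk>\<alpha> \<in> R; g \<in> reflection_group R\<rbrakk> \<Longrightarrow> root_reflection \<alpha> \<circ> g \<in> reflection_group R"

definition multiplicity_function :: "'a::euclidean_space set \<Rightarrow> ('a \<Rightarrow> real) \<Rightarrow> bool" where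
  "multiplicity_function R k \<longleftrightarrow>
     (\<forall>\<alpha>\<in>R. k \<alpha> \<ge> 0) \<and> (\<forall>g\<in>reflection_group R. \<forall>\<alpha>\<in>R. k (g \<alpha>) = k \<alpha>)"

definition k_index :: "'a::euclidean_space set \<Rightarrow> ('a \<Rightarrow> real) \<Rightarrow> real" where
  "k_index Rp k = (\<Sum>\<alpha>\<in>Rp. k \<alpha>)"

section \<open>Weights and Lebesgue spaces\<close>

text \<open>Since \<open>0 powr 0 = 0\<close>, the weights below may differ from the usual convention
  \<open>0\<^sup>0 = 1\<close> at the origin and on the hyperplanes orthogonal to the roots. This is a Lebesgue null
  set, so the measure is unaffected.\<close>

definition dunkl_weight :: "'a::euclidean_space set \<Rightarrow> ('a \<Rightarrow> real) \<Rightarrow> 'a \<Rightarrow> real" where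
  "dunkl_weight Rp k x = (\<Prod>\<alpha>\<in>Rp. \<bar>\<alpha> \<bullet> x\<bar> powr (2 * k \<alpha>))"

definition ka_weight :: "'a::euclidean_space set \<Rightarrow> ('a \<Rightarrow> real) \<Rightarrow> real \<Rightarrow> 'a \<Rightarrow> real" where
  "ka_weight Rp k a x = norm x powr (a - 2) * dunkl_weight Rp k x"

definition ka_measure :: "'a::euclidean_space set \<Rightarrow> ('a \<Rightarrow> real) \<Rightarrow> real \<Rightarrow> 'a measure" where
  "ka_measure Rp k a = density lborel (\<lambda>x. ennreal (ka_weight Rp k a x))"

text \<open>For real \<open>p > 0\<close>.\<close>

definition Lp_norm :: "'a measure \<Rightarrow> real \<Rightarrow> ('a \<Rightarrow> complex) \<Rightarrow> ennreal" where
  "Lp_norm M p f =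
     (let I = (\<integral>\<^sup>+x. ennreal (norm (f x) powr p) \<partial>M)
      in if I = \<infinity> then \<infinity> else ennreal (enn2real I powr (1 / p)))"

definition Linf_norm :: "'a measure \<Rightarrow> ('a \<Rightarrow> complex) \<Rightarrow> ennreal" where
  "Linf_norm M f = esssup M (\<lambda>x. ennreal (norm (f x)))"

definition Lp_space :: "'a measure \<Rightarrow> real \<Rightarrow> ('a \<Rightarrow> complex) set" where
  "Lp_space M p = {f \<in> borel_measurable M. Lp_norm M p f < \<infinity>}"

text \<open>Elements of \<open>L\<^sup>2\<close> are represented by functions, and an operator acts on representatives;
  all identities between functions are almost everywhere.\<close>

definition unitary_on_L2 :: "'a measure \<Rightarrow> (('a \<Rightarrow> complex) \<Rightarrow> ('a \<Rightarrow> complex)) \<Rightarrow> bool" where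
  "unitary_on_L2 M F \<longleftrightarrow>
     (\<forall>f\<in>Lp_space M 2. F f \<in> Lp_space M 2) \<and>
     (\<forall>f\<in>Lp_space M 2. \<forall>g\<in>Lp_space M 2.
        (AE x in M. f x = g x) \<longrightarrow> (AE x in M. F f x = F g x)) \<and>
     (\<forall>f\<in>Lp_space M 2. \<forall>g\<in>Lp_space M 2. \<forall>c d.
        AE x in M. F (\<lambda>y. c * f y + d * g y) x = c * F f x + d * F g x) \<and>
     (\<forall>f\<in>Lp_space M 2. \<forall>g\<in>Lp_space M 2.
        (\<integral>x. F f x * cnj (F g x) \<partial>M) = (\<integral>x. f x * cnj (g x) \<partial>M)) \<and>
     (\<forall>g\<in>Lp_space M 2. \<exists>f\<in>Lp_space M 2. AE x in M. F f x = g x)"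

section \<open>The Dunkl Laplacian and the generalized Fourier transform\<close>

definition partial_deriv :: "'a::euclidean_space \<Rightarrow> ('a \<Rightarrow> complex) \<Rightarrow> 'a \<Rightarrow> complex" where
  "partial_deriv b f x = vector_derivative (\<lambda>t. f (x + t *\<^sub>R b)) (at 0)"

definition laplacian :: "('a::euclidean_space \<Rightarrow> complex) \<Rightarrow> 'a \<Rightarrow> complex" where
  "laplacian f x = (\<Sum>b\<in>Basis. partial_deriv b (partial_deriv b f) x)"

definition gradient_inner :: "('a::euclidean_space \<Rightarrow> complex) \<Rightarrow> 'a \<Rightarrow> 'a \<Rightarrow> complex" where
  "gradient_inner f x \<alpha> = (\<Sum>b\<in>Basis. partial_deriv b f x * of_real (\<alpha> \<bullet> b))"

text \<open>The formula is meaningful only where \<open>\<alpha> \<bullet> x \<noteq> 0\<close> for all \<open>\<alpha> \<in> Rp\<close>.\<close>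

definition dunkl_laplacian ::
    "'a::euclidean_space set \<Rightarrow> ('a \<Rightarrow> real) \<Rightarrow> ('a \<Rightarrow> complex) \<Rightarrow> 'a \<Rightarrow> complex" where
  "dunkl_laplacian Rp k f x =
     laplacian f x +
     (\<Sum>\<alpha>\<in>Rp. of_real (k \<alpha>) *
        (2 * gradient_inner f x \<alpha> / of_real (\<alpha> \<bullet> x)
         - of_real ((norm \<alpha>)\<^sup>2) * ((f x - f (root_reflection \<alpha> x)) / of_real ((\<alpha> \<bullet> x)\<^sup>2))))"

text \<open>For a polynomial \<open>p\<close>, \<open>\<Delta>\<^sub>k p\<close> extends continuously from the dense complement of the root
  hyperplanes to a polynomial on the whole space; it vanishes identically iff it vanishes
  on that complement.\<close>

definition dunkl_harmonic_poly ::
    "'a::euclidean_space set \<Rightarrow> ('a \<Rightarrow> real) \<Rightarrow> nat \<Rightarrow> ('a \<Rightarrow> complex) \<Rightarrow> bool" where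
  "dunkl_harmonic_poly Rp k m p \<longleftrightarrow>
     polynomial_function p \<and>
     (\<forall>c x. p (c *\<^sub>R x) = of_real (c ^ m) * p x) \<and>
     (\<forall>x. (\<forall>\<alpha>\<in>Rp. \<alpha> \<bullet> x \<noteq> 0) \<longrightarrow> dunkl_laplacian Rp k p x = 0)"

definition laguerre :: "nat \<Rightarrow> real \<Rightarrow> real \<Rightarrow> real" where
  "laguerre l lam t = (\<Sum>j\<le>l. (-1) ^ j * ((real l + lam) gchoose (l - j)) * t ^ j / fact j)"

definition ka_lambda :: "'a::euclidean_space set \<Rightarrow> ('a \<Rightarrow> real) \<Rightarrow> real \<Rightarrow> nat \<Rightarrow> real" where
  "ka_lambda Rp k a m = (2 * real m + 2 * k_index Rp k + real DIM('a) - 2) / a"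

definition ka_Phi ::
    "'a::euclidean_space set \<Rightarrow> ('a \<Rightarrow> real) \<Rightarrow> real \<Rightarrow> nat \<Rightarrow> nat \<Rightarrow> ('a \<Rightarrow> complex) \<Rightarrow> 'a \<Rightarrow> complex" where
  "ka_Phi Rp k a l m p x =
     p x * of_real (laguerre l (ka_lambda Rp k a m) (2 / a * norm x powr a) * exp (- (norm x powr a) / a))"

text \<open>The transform is specified as a unitary operator with the prescribed action on the total
  family \<open>\<Phi>\<^sub>l(p, _)\<close>, which determines it up to almost everywhere equality; the
  predicate therefore ranges over the choices of representatives of \<open>F f\<close>.\<close>

definition is_ka_fourier ::
    "'a::euclidean_space set \<Rightarrow> ('a \<Rightarrow> real) \<Rightarrow> real \<Rightarrow> (('a \<Rightarrow> complex) \<Rightarrow> ('a \<Rightarrow> complex)) \<Rightarrow> bool" where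
  "is_ka_fourier Rp k a F \<longleftrightarrow>
     unitary_on_L2 (ka_measure Rp k a) F \<and>
     (\<forall>l m p. dunkl_harmonic_poly Rp k m p \<longrightarrow>
        (AE x in ka_measure Rp k a.
           F (ka_Phi Rp k a l m p) x =
             exp (- \<i> * of_real (pi * (real l + real m / a))) * ka_Phi Rp k a l m p x))"

end

theory Submission
  imports Defs
begin

text \<open>
  With \<open>D = a + 2\<langle>k\<rangle> + N - 2 > 0\<close>, homogeneity of the weight gives \<open>\<mu>(ball 0 r) \<le> c r\<^sup>D\<close>.
  Put \<open>A = \<parallel>f\<parallel>\<^sub>1\<close> and \<open>Q = \<parallel>f\<parallel>\<^sub>2\<^sup>2 = \<parallel>F f\<parallel>\<^sub>2\<^sup>2\<close>. Since \<open>\<bar>F f\<bar> \<le> C A\<close>, at most half of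
  the mass of \<open>\<bar>F f\<bar>\<^sup>2\<close> lies in a ball with \<open>r\<^sup>D \<sim> Q / A\<^sup>2\<close>; by Cauchy-Schwarz, at most half of the
  mass of \<open>\<bar>f\<bar>\<close> lies in a ball with \<open>\<rho>\<^sup>D \<sim> A\<^sup>2 / Q\<close>. The mass outside these balls bounds the two
  moments from below, and in the product the ratio \<open>Q / A\<^sup>2\<close> cancels.
\<close>

section \<open>Growth of balls under a homogeneous density\<close>

text \<open>Substituting \<open>r *\<^sub>R x\<close> for \<open>x\<close> contributes the Jacobian
  \<open>r ^ DIM('a)\<close> and the homogeneity factor \<open>r powr (D - real DIM('a))\<close>,
  whose product is \<open>r powr D\<close>. The dilate of \<open>S\<close> by \<open>r\<close> is
  written as a preimage, which makes its measurability immediate.\<close>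

lemma emeasure_density_homogeneous:
  fixes w :: "'a::euclidean_space \<Rightarrow> real"
  assumes [measurable]: "w \<in> borel_measurable borel" "S \<in> sets borel"
    and r: "r > 0"
    and hom: "\<And>x. w (r *\<^sub>R x) = r powr (D - real DIM('a)) * w x"
  shows "emeasure (density lborel (\<lambda>x. ennreal (w x))) ((\<lambda>x. x /\<^sub>R r) -` S)
    = ennreal (r powr D) * emeasure (density lborel (\<lambda>x. ennreal (w x))) S"
proof -
  let ?S = "(\<lambda>x. x /\<^sub>R r) -` S"
  have [measurable]: "?S \<in> sets borel"
    by (rule measurable_sets_borel[OF _ assms(2)]) measurable
  have pow: "r powr D = \<bar>r\<bar> ^ DIM('a) * r powr (D - real DIM('a))"
    using r by (simp add: powr_diff powr_realpow)
  have "emeasure (density lborel (\<lambda>x. ennreal (w x))) ?S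
      = (\<integral>\<^sup>+x. ennreal (w x) * indicator ?S x \<partial>lborel)"
    by (rule emeasure_density) auto
  also have "\<dots> = (\<integral>\<^sup>+x. ennreal (w x) * indicator ?S x
      \<partial>density (distr lborel borel (\<lambda>x. 0 + r *\<^sub>R x)) (\<lambda>_. \<bar>r\<bar>^DIM('a)))"
    using lborel_affine[of r "0::'a"] r by simp
  also have "\<dots> = (\<integral>\<^sup>+x. ennreal (\<bar>r\<bar>^DIM('a)) * (ennreal (w (r *\<^sub>R x)) * indicator ?S (r *\<^sub>R x)) \<partial>lborel)"
    by (simp add: nn_integral_density nn_integral_distr)
  also have "\<dots> = (\<integral>\<^sup>+x. ennreal (r powr D) * (ennreal (w x) * indicator S x) \<partial>lborel)"
    using r by (intro nn_integral_cong)
      (auto simp: hom pow ennreal_mult' mult.assoc indicator_def)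
  also have "\<dots> = ennreal (r powr D) * (\<integral>\<^sup>+x. ennreal (w x) * indicator S x \<partial>lborel)"
    by (rule nn_integral_cmult) measurable
  also have "(\<integral>\<^sup>+x. ennreal (w x) * indicator S x \<partial>lborel)
      = emeasure (density lborel (\<lambda>x. ennreal (w x))) S"
    by (rule emeasure_density[symmetric]) auto
  finally show ?thesis .
qed

text \<open>By scaling, it is enough that the unit ball has finite mass. This needs an argument
  because \<open>w\<close> may blow up at the origin when \<open>D < DIM('a)\<close>. Cut the
  punctured ball into dyadic annuli: the one scaled by \<open>(1/2) ^ n\<close> has mass
  \<open>q ^ n\<close> times that of the outermost, where \<open>q = (1/2) powr D < 1\<close>, so
  the masses are dominated by a geometric series.\<close>

lemma emeasure_density_ball_homogeneous:
  fixes w :: "'a::euclidean_space \<Rightarrow> real"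
  assumes [measurable]: "w \<in> borel_measurable borel"
    and D: "D > 0"
    and hom: "\<And>r x. r > 0 \<Longrightarrow> w (r *\<^sub>R x) = r powr (D - real DIM('a)) * w x"
    and bdd: "\<And>x. 1/2 \<le> norm x \<Longrightarrow> norm x < 1 \<Longrightarrow> w x \<le> K"
  obtains c where "c > 0"
    "\<And>r. r > 0 \<Longrightarrow> emeasure (density lborel (\<lambda>x. ennreal (w x))) (ball 0 r) \<le> ennreal (c * r powr D)"
proof -
  let ?M = "density lborel (\<lambda>x. ennreal (w x))"
  define A where "A = ball 0 1 - ball (0::'a) (1/2)"
  have [measurable]: "A \<in> sets borel"
    by (simp add: A_def)
  have "emeasure ?M A = (\<integral>\<^sup>+x. ennreal (w x) * indicator A x \<partial>lborel)"
    by (rule emeasure_density) auto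
  also have "\<dots> \<le> (\<integral>\<^sup>+x. ennreal K * indicator (ball (0::'a) 1) x \<partial>lborel)"
    by (intro nn_integral_mono)
      (auto simp: A_def indicator_def dist_norm intro!: ennreal_leI bdd)
  also have "\<dots> < \<infinity>"
    using emeasure_lborel_ball_finite[of "0::'a" 1]
    by (simp add: nn_integral_cmult_indicator ennreal_mult_less_top)
  finally have finA: "emeasure ?M A < \<infinity>" .
  define q where "q = (1/2) powr D"
  have q: "0 < q" "q < 1"
    using D powr_less_mono2[of D "1/2" 1] by (auto simp: q_def)
  define P where "P n = (\<lambda>x. x /\<^sub>R ((1/2) ^ n)) -` A" for n :: nat
  have P_sets: "P n \<in> sets borel" for n
    unfolding P_def by (rule measurable_sets_borel[of _ borel]) measurable
  have P_measure: "emeasure ?M (P n) = ennreal (q ^ n) * emeasure ?M A" for n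
  proof -
    have "((1/2::real) ^ n) powr D = q ^ n"
      by (simp add: q_def powr_realpow[symmetric] powr_powr mult.commute)
    then show ?thesis
      unfolding P_def using hom by (subst emeasure_density_homogeneous[where D = D]) auto
  qed
  have cover: "ball 0 1 \<subseteq> {0} \<union> (\<Union>n. P n)"
  proof
    fix x :: 'a assume x: "x \<in> ball 0 1"
    show "x \<in> {0} \<union> (\<Union>n. P n)"
    proof (cases "x = 0")
      case False
      \<comment> \<open>Minimality of \<open>n\<close> places \<open>x\<close> between two
        consecutive dyadic radii. As \<open>norm x < 1\<close>, \<open>n\<close> has a predecessor
        \<open>m\<close>, and \<open>(1/2) ^ Suc m \<le> norm x < (1/2) ^ m\<close> says exactly
        that \<open>x\<close> lies in \<open>P m\<close>.\<close>
      define n where "n = (LEAST n. (1/2) ^ n \<le> norm x)"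
      have ex: "\<exists>n. (1/2::real) ^ n \<le> norm x"
        using real_arch_pow_inv[of "norm x" "1/2"] False by (auto intro: less_imp_le)
      have n: "(1/2) ^ n \<le> norm x"
        unfolding n_def by (rule LeastI_ex[OF ex])
      have "n \<noteq> 0"
        using n x by (auto intro: Nat.gr0I)
      then obtain m where m: "n = Suc m"
        by (cases n) auto
      have "\<not> (1/2) ^ m \<le> norm x"
        using not_less_Least[of m "\<lambda>n. (1/2) ^ n \<le> norm x"] m n_def by simp
      then have "x \<in> P m"
        using n m by (auto simp: P_def A_def field_simps)
      then show ?thesis by auto
    qed simp
  qed
  have null: "emeasure ?M {0} = 0"
    by (subst emeasure_density) (auto intro!: nn_integral_0_iff_AE[THEN iffD2] AE_I[of _ _ "{0}"])
  have "emeasure ?M (ball 0 1) \<le> emeasure ?M ({0} \<union> (\<Union>n. P n))"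
    using cover P_sets by (intro emeasure_mono) auto
  also have "\<dots> \<le> emeasure ?M {0} + emeasure ?M (\<Union>n. P n)"
    using P_sets by (intro emeasure_subadditive) auto
  also have "\<dots> \<le> (\<Sum>n. emeasure ?M (P n))"
    unfolding null using P_sets by (simp, intro emeasure_subadditive_countably) auto
  also have "\<dots> = ennreal (\<Sum>n. q ^ n) * emeasure ?M A"
    using q by (simp add: P_measure suminf_ennreal2)
  also have "\<dots> < \<infinity>"
    using finA by (simp add: ennreal_mult_less_top)
  finally have "emeasure ?M (ball 0 1) < \<infinity>" .
  then obtain b where b: "b \<ge> 0" "emeasure ?M (ball 0 1) = ennreal b"
    by (cases "emeasure ?M (ball 0 1)") auto
  \<comment> \<open>\<open>b\<close> may be 0, for instance when \<open>w\<close> vanishes;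
    \<open>b + 1\<close> keeps the constant strictly positive.\<close>
  have "emeasure ?M (ball 0 r) \<le> ennreal ((b + 1) * r powr D)" if r: "r > 0" for r
  proof -
    have "ball (0::'a) r = (\<lambda>x. x /\<^sub>R r) -` ball 0 1"
      using r by (auto simp: field_simps)
    then have "emeasure ?M (ball 0 r) = ennreal (r powr D) * ennreal b"
      using r hom b by (simp add: emeasure_density_homogeneous[where D = D])
    also have "\<dots> \<le> ennreal ((b + 1) * r powr D)"
      using b by (simp add: ennreal_mult'[symmetric] ennreal_leI algebra_simps)
    finally show ?thesis .
  qed
  with b show ?thesis
    by (intro that[of "b + 1"]) auto
qed

section \<open>Lower bounds for moments\<close>

text \<open>If at most half of the mass of \<open>h\<close> lies in the ball, at least half lies
  outside, where \<open>norm x powr t \<ge> r powr t\<close>. It serves both for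
  \<open>h = \<bar>f\<bar>\<close> and for the squared modulus of the transform.\<close>

lemma nn_integral_moment_lower_bound:
  fixes h :: "'a::euclidean_space \<Rightarrow> ennreal"
  assumes sets: "sets M = sets borel" and h[measurable]: "h \<in> borel_measurable M"
    and I: "(\<integral>\<^sup>+x. h x \<partial>M) = ennreal I" "I \<ge> 0"
    and ball: "(\<integral>\<^sup>+x. h x * indicator (ball 0 r) x \<partial>M) \<le> ennreal (I / 2)"
    and "r > 0" "t \<ge> 0"
  shows "ennreal (r powr t * I / 2) \<le> (\<integral>\<^sup>+x. ennreal (norm x powr t) * h x \<partial>M)"
proof -
  have [measurable_cong]: "sets M = sets borel" by (rule sets)
  have [measurable]: "ball (0::'a) r \<in> sets M"
    by (simp add: sets)
  let ?J = "\<integral>\<^sup>+x. h x * indicator (- ball 0 r) x \<partial>M"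
  have "ennreal (I/2) + ennreal (I/2) = (\<integral>\<^sup>+x. h x \<partial>M)"
    using I by (simp flip: ennreal_plus)
  also have "\<dots> = (\<integral>\<^sup>+x. h x * indicator (ball 0 r) x + h x * indicator (- ball 0 r) x \<partial>M)"
    by (intro nn_integral_cong) (auto simp: indicator_def)
  also have "\<dots> = (\<integral>\<^sup>+x. h x * indicator (ball 0 r) x \<partial>M) + ?J"
    by (rule nn_integral_add) measurable
  also have "\<dots> \<le> ennreal (I/2) + ?J"
    using ball by (rule add_right_mono)
  \<comment> \<open>The summand \<open>ennreal (I/2)\<close> is finite and therefore
    cancels.\<close>
  finally have J: "ennreal (I/2) \<le> ?J"
    by simp
  have "ennreal (r powr t * I / 2) = ennreal (r powr t) * ennreal (I / 2)"
    using I by (simp add: ennreal_mult'[symmetric])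
  also have "\<dots> \<le> ennreal (r powr t) * ?J"
    using J by (rule mult_left_mono) simp
  also have "\<dots> = (\<integral>\<^sup>+x. ennreal (r powr t) * (h x * indicator (- ball 0 r) x) \<partial>M)"
    by (rule nn_integral_cmult[symmetric]) measurable
  also have "\<dots> \<le> (\<integral>\<^sup>+x. ennreal (norm x powr t) * h x \<partial>M)"
    using assms by (intro nn_integral_mono)
      (auto simp: indicator_def intro!: mult_right_mono ennreal_leI powr_mono2)
  finally show ?thesis .
qed

lemma power2_le_ennrealD:
  assumes "x\<^sup>2 \<le> (ennreal b)\<^sup>2" "b \<ge> 0"
  shows "x \<le> ennreal b"
  using assms by (cases x) (auto simp: ennreal_power top_unique intro: ennreal_leI power2_le_imp_le)

text \<open>This isolates the measure-theoretic core, with \<open>g\<close> in the role of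
  \<open>F f\<close>: the transform enters through Plancherel (\<open>g2\<close>) and the kernel
  bound (\<open>g_inf\<close>). Both moments carry the same exponent \<open>t\<close>, later
  \<open>2 * s\<close>, so that the two radii combine into one power of
  \<open>u * v\<close>.\<close>

lemma moment_product_lower_bound:
  fixes f g :: "'a::euclidean_space \<Rightarrow> complex"
  assumes sets: "sets M = sets borel"
    and ball: "\<And>r. r > 0 \<Longrightarrow> emeasure M (ball 0 r) \<le> ennreal (c * r powr D)"
    and pos: "c > 0" "D > 0" "C > 0" "t \<ge> 0" "A > 0" "Q > 0"
    and meas[measurable]: "f \<in> borel_measurable M" "g \<in> borel_measurable M"
    and f1: "(\<integral>\<^sup>+x. ennreal (norm (f x)) \<partial>M) = ennreal A"
    and f2: "(\<integral>\<^sup>+x. ennreal ((norm (f x))\<^sup>2) \<partial>M) = ennreal Q"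
    and g2: "(\<integral>\<^sup>+x. ennreal ((norm (g x))\<^sup>2) \<partial>M) = ennreal Q"
    and g_inf: "AE x in M. norm (g x) \<le> C * A"
  shows "ennreal ((1 / (8 * c\<^sup>2 * C\<^sup>2)) powr (t / D) / 4 * A * Q) \<le>
     (\<integral>\<^sup>+x. ennreal (norm x powr t) * ennreal (norm (f x)) \<partial>M) *
     (\<integral>\<^sup>+x. ennreal (norm x powr t) * ennreal ((norm (g x))\<^sup>2) \<partial>M)"
proof -
  have [measurable_cong]: "sets M = sets borel" by (rule sets)
  have [measurable]: "ball (0::'a) r \<in> sets M" for r
    by (simp add: sets)
  \<comment> \<open>\<open>u\<close> and \<open>v\<close> are the values of \<open>r powr D\<close>
    and \<open>\<rho> powr D\<close> that solve \<open>(C * A)\<^sup>2 * (c * u) = Q / 2\<close> and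
    \<open>Q * (c * v) = (A / 2)\<^sup>2\<close>: the ball estimates then give exactly half of the
    mass.\<close>
  define u where "u = Q / (2 * c * C\<^sup>2 * A\<^sup>2)"
  define v where "v = A\<^sup>2 / (4 * c * Q)"
  have uv: "u > 0" "v > 0"
    using pos by (auto simp: u_def v_def)
  define r where "r = u powr (1 / D)"
  define \<rho> where "\<rho> = v powr (1 / D)"
  have r: "r > 0" "r powr D = u" and \<rho>: "\<rho> > 0" "\<rho> powr D = v"
    using uv pos by (auto simp: r_def \<rho>_def powr_powr)

  have "(\<integral>\<^sup>+x. ennreal ((norm (g x))\<^sup>2) * indicator (ball 0 r) x \<partial>M)
      \<le> (\<integral>\<^sup>+x. ennreal ((C * A)\<^sup>2) * indicator (ball 0 r) x \<partial>M)"
    using g_inf by (intro nn_integral_mono_AE, eventually_elim)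
      (auto simp: indicator_def intro!: ennreal_leI power_mono)
  also have "\<dots> = ennreal ((C * A)\<^sup>2) * emeasure M (ball 0 r)"
    by (simp add: nn_integral_cmult_indicator)
  also have "\<dots> \<le> ennreal ((C * A)\<^sup>2) * ennreal (c * r powr D)"
    using ball[OF r(1)] by (rule mult_left_mono) simp
  also have "\<dots> = ennreal (Q / 2)"
    using pos by (simp add: r u_def ennreal_mult'[symmetric] power_mult_distrib)
  finally have bg: "ennreal (r powr t * Q / 2)
      \<le> (\<integral>\<^sup>+x. ennreal (norm x powr t) * ennreal ((norm (g x))\<^sup>2) \<partial>M)"
    using pos r by (intro nn_integral_moment_lower_bound[OF sets _ g2]) auto

  \<comment> \<open>No sup bound on \<open>f\<close> is available, so its mass in the ball is
    controlled by pairing \<open>f\<close> with the indicator in L2.\<close>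
  have "(\<integral>\<^sup>+x. ennreal (norm (f x)) * indicator (ball 0 \<rho>) x \<partial>M)\<^sup>2
      \<le> (\<integral>\<^sup>+x. (ennreal (norm (f x)))\<^sup>2 \<partial>M) * (\<integral>\<^sup>+x. (indicator (ball 0 \<rho>) x)\<^sup>2 \<partial>M)"
    by (rule Cauchy_Schwarz_nn_integral) measurable
  also have "(\<integral>\<^sup>+x. (ennreal (norm (f x)))\<^sup>2 \<partial>M) = ennreal Q"
    using f2 by (simp add: ennreal_power)
  also have "(\<integral>\<^sup>+x. (indicator (ball 0 \<rho>) x)\<^sup>2 \<partial>M) = emeasure M (ball 0 \<rho>)"
    by (simp add: power2_eq_square flip: indicator_inter_arith)
  also have "ennreal Q * emeasure M (ball 0 \<rho>) \<le> ennreal Q * ennreal (c * \<rho> powr D)"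
    using ball[OF \<rho>(1)] by (rule mult_left_mono) simp
  also have "\<dots> = (ennreal (A / 2))\<^sup>2"
    using pos by (simp add: \<rho> v_def ennreal_mult'[symmetric] ennreal_power power_divide)
  finally have "(\<integral>\<^sup>+x. ennreal (norm (f x)) * indicator (ball 0 \<rho>) x \<partial>M) \<le> ennreal (A / 2)"
    using pos by (intro power2_le_ennrealD) auto
  then have bf: "ennreal (\<rho> powr t * A / 2)
      \<le> (\<integral>\<^sup>+x. ennreal (norm x powr t) * ennreal (norm (f x)) \<partial>M)"
    using pos \<rho> by (intro nn_integral_moment_lower_bound[OF sets _ f1]) auto

  \<comment> \<open>\<open>A\<close> and \<open>Q\<close> cancel here, which makes the final
    constant independent of \<open>f\<close>.\<close>
  have "v * u = 1 / (8 * c\<^sup>2 * C\<^sup>2)"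
    using pos by (simp add: u_def v_def power2_eq_square)
  then have "\<rho> powr t * r powr t = (1 / (8 * c\<^sup>2 * C\<^sup>2)) powr (t / D)"
    using uv by (simp add: \<rho>_def r_def powr_powr flip: powr_mult)
  then have "ennreal ((1 / (8 * c\<^sup>2 * C\<^sup>2)) powr (t / D) / 4 * A * Q)
      = ennreal (\<rho> powr t * A / 2) * ennreal (r powr t * Q / 2)"
    using pos by (simp add: ennreal_mult'[symmetric] mult_ac)
  with mult_mono[OF bf bg] show ?thesis by simp
qed

section \<open>Norms as integrals, and Plancherel\<close>

lemma Lp_norm_1: "Lp_norm M 1 f = (\<integral>\<^sup>+x. ennreal (norm (f x)) \<partial>M)"
  by (auto simp: Lp_norm_def Let_def less_top)

lemma Lp_norm_2_squared: "(Lp_norm M 2 f)\<^sup>2 = (\<integral>\<^sup>+x. ennreal ((norm (f x))\<^sup>2) \<partial>M)"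
  by (auto simp: Lp_norm_def Let_def less_top ennreal_power powr_half_sqrt)

text \<open>Take \<open>g = f\<close> in the preservation of the inner product. That inner product
  is a Bochner integral, which would be 0 for a non-integrable integrand; membership in
  \<open>Lp_space M 2\<close> gives integrability and identifies it with the nonnegative
  integral.\<close>

lemma unitary_on_L2_norm:
  assumes "unitary_on_L2 M F" "f \<in> Lp_space M 2"
  shows "(Lp_norm M 2 (F f))\<^sup>2 = (Lp_norm M 2 f)\<^sup>2"
proof -
  have sq: "(\<integral>\<^sup>+x. ennreal ((norm (h x))\<^sup>2) \<partial>M) = ennreal (Re (\<integral>x. h x * cnj (h x) \<partial>M))"
    if h: "h \<in> Lp_space M 2" for h
  proof -
    have [measurable]: "h \<in> borel_measurable M" and fin: "Lp_norm M 2 h < \<infinity>"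
      using h by (auto simp: Lp_space_def)
    from fin have "(Lp_norm M 2 h)\<^sup>2 < \<infinity>"
      by (simp add: power_less_top_ennreal)
    then have "integrable M (\<lambda>x. (norm (h x))\<^sup>2)"
      by (simp add: Lp_norm_2_squared integrable_iff_bounded)
    then have "(\<integral>\<^sup>+x. ennreal ((norm (h x))\<^sup>2) \<partial>M) = ennreal (\<integral>x. (norm (h x))\<^sup>2 \<partial>M)"
      by (intro nn_integral_eq_integral) auto
    also have "(\<integral>x. (norm (h x))\<^sup>2 \<partial>M) = Re (\<integral>x. h x * cnj (h x) \<partial>M)"
      by (simp add: complex_norm_square[symmetric] flip: of_real_power)
    finally show ?thesis .
  qed
  have "F f \<in> Lp_space M 2" "(\<integral>x. F f x * cnj (F f x) \<partial>M) = (\<integral>x. f x * cnj (f x) \<partial>M)"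
    using assms by (auto simp: unitary_on_L2_def)
  with assms(2) show ?thesis
    by (simp add: Lp_norm_2_squared sq)
qed

section \<open>Homogeneity and local bounds of the weight\<close>

lemma dunkl_weight_scaleR:
  assumes "r > 0"
  shows "dunkl_weight Rp k (r *\<^sub>R x) = r powr (2 * k_index Rp k) * dunkl_weight Rp k x"
  using assms by (simp add: dunkl_weight_def k_index_def abs_mult powr_mult prod.distrib
      powr_sum sum_distrib_left)

lemma ka_weight_scaleR:
  assumes "r > 0"
  shows "ka_weight Rp k a (r *\<^sub>R x) = r powr (a - 2 + 2 * k_index Rp k) * ka_weight Rp k a x"
  using assms by (simp add: ka_weight_def dunkl_weight_scaleR powr_mult powr_add)

lemma borel_measurable_ka_weight [measurable]: "ka_weight Rp k a \<in> borel_measurable borel"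
  unfolding ka_weight_def dunkl_weight_def by measurable

text \<open>The radial exponent \<open>a - 2\<close> can have either sign. On the annulus the radial
  factor is at most 1 if \<open>a \<ge> 2\<close> and at most \<open>(1/2) powr (a - 2)\<close>
  otherwise; the sum of the two bounds covers both cases. Cauchy-Schwarz bounds the remaining
  factors.\<close>

lemma ka_weight_annulus_le:
  assumes k: "\<And>\<alpha>. \<alpha> \<in> Rp \<Longrightarrow> k \<alpha> \<ge> 0" and x: "1/2 \<le> norm x" "norm x < 1"
  shows "ka_weight Rp k a x \<le> (1 + (1/2) powr (a - 2)) * (\<Prod>\<alpha>\<in>Rp. norm \<alpha> powr (2 * k \<alpha>))"
  unfolding ka_weight_def dunkl_weight_def
proof (intro mult_mono prod_mono conjI powr_mono2)
  show "norm x powr (a - 2) \<le> 1 + (1/2) powr (a - 2)"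
  proof (cases "a \<ge> 2")
    case True
    with x have "norm x powr (a - 2) \<le> 1"
      by (intro powr_le1) auto
    then show ?thesis by (rule add_increasing2[rotated]) simp
  next
    case False
    then have "norm x powr (a - 2) \<le> (1/2) powr (a - 2)"
      using x by (intro powr_mono2') auto
    then show ?thesis by simp
  qed
next
  fix \<alpha> assume "\<alpha> \<in> Rp"
  show "\<bar>\<alpha> \<bullet> x\<bar> \<le> norm \<alpha>"
    using Cauchy_Schwarz_ineq2[of \<alpha> x] mult_left_mono[of "norm x" 1 "norm \<alpha>"] x by simp
qed (use k in \<open>auto intro: prod_nonneg\<close>)

theorem proposition6p3:
  fixes R Rp :: "(real ^ 'n) set"
    and k :: "real ^ 'n \<Rightarrow> real"
    and a s :: real
    and F :: "(real ^ 'n \<Rightarrow> complex) \<Rightarrow> (real ^ 'n \<Rightarrow> complex)"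
  defines "\<mu> \<equiv> ka_measure Rp k a"
  assumes "reduced_root_system R"
    and "positive_subsystem R Rp"
    and "multiplicity_function R k"
    and "a > 0"
    and "a + 2 * k_index Rp k + real CARD('n) > 2"
    and "is_ka_fourier Rp k a F"
    and "\<exists>C0::real. \<forall>f \<in> Lp_space \<mu> 1 \<inter> Lp_space \<mu> 2.
           Linf_norm \<mu> (F f) \<le> ennreal C0 * Lp_norm \<mu> 1 f"
    and "s > 0"
  shows "\<exists>C'::real. C' > 0 \<and>
    (\<forall>f \<in> Lp_space \<mu> 1 \<inter> Lp_space \<mu> 2.
       Lp_norm \<mu> 1 (\<lambda>x. of_real (norm x powr (2 * s)) * f x) *
         (Lp_norm \<mu> 2 (\<lambda>x. of_real (norm x powr s) * F f x))\<^sup>2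
       \<ge> ennreal C' * Lp_norm \<mu> 1 f * (Lp_norm \<mu> 2 f)\<^sup>2)"
proof -
  define D where "D = a + 2 * k_index Rp k + real CARD('n) - 2"
  have D: "D > 0"
    using assms(6) by (simp add: D_def)
  have sets: "sets \<mu> = sets borel"
    by (simp add: \<mu>_def ka_measure_def)
  have unitary: "unitary_on_L2 \<mu> F"
    using assms(7) by (simp add: is_ka_fourier_def \<mu>_def)
  have k: "k \<alpha> \<ge> 0" if "\<alpha> \<in> Rp" for \<alpha>
    using that assms(3,4) by (auto simp: positive_subsystem_def multiplicity_function_def)
  obtain c where c: "c > 0" "\<And>r. r > 0 \<Longrightarrow> emeasure \<mu> (ball 0 r) \<le> ennreal (c * r powr D)"
    unfolding \<mu>_def ka_measure_def
  proof (rule emeasure_density_ball_homogeneous)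
    show "ka_weight Rp k a x \<le> (1 + (1/2) powr (a - 2)) * (\<Prod>\<alpha>\<in>Rp. norm \<alpha> powr (2 * k \<alpha>))"
      if "1/2 \<le> norm x" "norm x < 1" for x
      using k that by (rule ka_weight_annulus_le)
    show "ka_weight Rp k a (r *\<^sub>R x) = r powr (D - real DIM(real^'n)) * ka_weight Rp k a x"
      if "r > 0" for r x
      using ka_weight_scaleR[OF that, of Rp k a x] by (simp add: D_def algebra_simps)
  qed (use D in auto)
  obtain C0 :: real where C0: "\<And>f. f \<in> Lp_space \<mu> 1 \<inter> Lp_space \<mu> 2 \<Longrightarrow>
      Linf_norm \<mu> (F f) \<le> ennreal C0 * Lp_norm \<mu> 1 f"
    using assms(8) by blast
  \<comment> \<open>\<open>C0\<close> is an arbitrary real and may be nonpositive; the radii require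
    division by a positive constant.\<close>
  define C where "C = max C0 1"
  have C: "C > 0" "C0 \<le> C"
    by (auto simp: C_def)
  define C' where "C' = (1 / (8 * c\<^sup>2 * C\<^sup>2)) powr (2 * s / D) / 4"
  show ?thesis
  proof (intro exI conjI ballI)
    show "C' > 0"
      using c C by (simp add: C'_def)
    fix f assume f: "f \<in> Lp_space \<mu> 1 \<inter> Lp_space \<mu> 2"
    then have meas: "f \<in> borel_measurable \<mu>" and Ff: "F f \<in> borel_measurable \<mu>"
      using unitary by (auto simp: Lp_space_def unitary_on_L2_def)
    obtain A where A: "Lp_norm \<mu> 1 f = ennreal A" "A \<ge> 0"
      using f by (cases "Lp_norm \<mu> 1 f") (auto simp: Lp_space_def)
    obtain B where B: "Lp_norm \<mu> 2 f = ennreal B" "B \<ge> 0"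
      using f by (cases "Lp_norm \<mu> 2 f") (auto simp: Lp_space_def)
    have f2: "(\<integral>\<^sup>+x. ennreal ((norm (f x))\<^sup>2) \<partial>\<mu>) = ennreal (B\<^sup>2)"
      using B by (simp add: ennreal_power flip: Lp_norm_2_squared)
    have Ff2: "(\<integral>\<^sup>+x. ennreal ((norm (F f x))\<^sup>2) \<partial>\<mu>) = ennreal (B\<^sup>2)"
      using unitary_on_L2_norm[OF unitary, of f] f f2 by (simp add: Lp_norm_2_squared)
    have "ennreal (norm (F f x)) \<le> Linf_norm \<mu> (F f) \<Longrightarrow> norm (F f x) \<le> C * A" for x
    proof -
      assume "ennreal (norm (F f x)) \<le> Linf_norm \<mu> (F f)"
      also have "\<dots> \<le> ennreal C * ennreal A"
        using C0[OF f] C A by (auto intro!: order_trans[OF _ mult_right_mono[OF ennreal_leI[OF C(2)]]])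
      finally show ?thesis
        using C A by (simp add: ennreal_mult'[symmetric])
    qed
    then have inf: "AE x in \<mu>. norm (F f x) \<le> C * A"
      using esssup_AE[of "\<lambda>x. ennreal (norm (F f x))" \<mu>] unfolding Linf_norm_def by auto
    show "ennreal C' * Lp_norm \<mu> 1 f * (Lp_norm \<mu> 2 f)\<^sup>2
        \<le> Lp_norm \<mu> 1 (\<lambda>x. of_real (norm x powr (2 * s)) * f x) *
          (Lp_norm \<mu> 2 (\<lambda>x. of_real (norm x powr s) * F f x))\<^sup>2"
    \<comment> \<open>The radii involve the ratio of \<open>A\<^sup>2\<close> and
      \<open>B\<^sup>2\<close>, so both must be nonzero; otherwise the lower bound to be shown is
      0.\<close>
    proof (cases "A = 0 \<or> B = 0")
      case True
      then show ?thesis using A B by auto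
    next
      case False
      have "ennreal (C' * A * B\<^sup>2) \<le>
        (\<integral>\<^sup>+x. ennreal (norm x powr (2 * s)) * ennreal (norm (f x)) \<partial>\<mu>) *
        (\<integral>\<^sup>+x. ennreal (norm x powr (2 * s)) * ennreal ((norm (F f x))\<^sup>2) \<partial>\<mu>)"
        unfolding C'_def
        using False A B C D c(1) \<open>s > 0\<close>
        by (intro moment_product_lower_bound[OF sets c(2) _ _ _ _ _ _ meas Ff _ f2 Ff2 inf])
          (auto simp flip: Lp_norm_1)
      \<comment> \<open>Squaring the L2 norm turns the weight \<open>norm x powr s\<close> into
        \<open>norm x powr (2 * s)\<close>, the exponent of the L1 moment.\<close>
      moreover have "norm x powr (2 * s) = (norm x powr s)\<^sup>2" for x :: "real^'n"
        by (simp add: power2_eq_square flip: powr_add)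
      moreover have "ennreal C' * ennreal A * (ennreal B)\<^sup>2 = ennreal (C' * A * B\<^sup>2)"
        using A B by (simp add: C'_def ennreal_power flip: ennreal_mult')
      ultimately show ?thesis
        by (simp only: A(1)[unfolded Lp_norm_1] B(1) Lp_norm_1 Lp_norm_2_squared norm_mult power_mult_distrib
            ennreal_mult' norm_of_real abs_power2 power2_abs zero_le_power2)
    qed
  qed
qed

end
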